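(* For all $a,m\in\mathbb{N}$ and $n\in\mathbb{N}_0$, $\mathrm{cp}^o_{a,a,m}(n)\le \mathrm{cp}^e_{a,a,m}(n)$. Equivalently, the $q$-series $$\frac{(-q^{2a};q^m)_\infty}{(-q^a;q^m)_\infty(q^a;q^m)_\infty}$$ has non-negative coefficients.
   Context: A partition of $n$ is a non-increasing finite sequence of positive integers summing to $n$; $\nu(\lambda)$ denotes its number of parts and $|\lambda|$ its sum. For $a,b,m\in\mathbb{N}$, an $(a,b,m)$-copartition is a triple of partitions $(\gamma,\rho,\sigma)$ such that every part of $\gamma$ (the "ground") is $\equiv a \pmod m$ and at least $a$, every part of $\sigma$ (the "sky") is $\equiv b\pmod m$ and at least $b$, and $\rho$ consists of exactly $\nu(\sigma)$ parts each equal to $m\cdot\nu(\gamma)$ (these contribute nothing when $\gamma$ is empty). Its size is $|\gamma|+|\rho|+|\sigma|$. $\mathrm{cp}^o_{a,b,m}(n)$ (resp. $\mathrm{cp}^e_{a,b,m}(n)$) is the number of $(a,b,m)$-copartitions of size $n$ whose ground has an odd (resp. even) number of parts. Notation: $(x;q)_\infty=\prod_{k\ge0}(1-xq^k)$. *)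

theory Defs
  imports
    "HOL-Number_Theory.Cong"
    "HOL-Computational_Algebra.Formal_Power_Series"
    "HOL-Analysis.Infinite_Products"
begin

definition int_partition :: "nat list \<Rightarrow> bool" where
  "int_partition xs \<longleftrightarrow> sorted_wrt (\<ge>) xs \<and> (\<forall>x\<in>set xs. 0 < x)"

text \<open>The triples are (ground, \<open>\<rho>\<close>, sky). With an empty ground, \<open>\<rho>\<close> would consist of
  zeros, which are not parts of a partition; it is then taken to be empty.\<close>

definition copartitions :: "nat \<Rightarrow> nat \<Rightarrow> nat \<Rightarrow> (nat list \<times> nat list \<times> nat list) set" where
  "copartitions a b m = {(\<gamma>, \<rho>, \<sigma>).
     int_partition \<gamma> \<and> int_partition \<rho> \<and> int_partition \<sigma> \<and>
     (\<forall>x\<in>set \<gamma>. [x = a] (mod m) \<and> a \<le> x) \<and>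
     (\<forall>x\<in>set \<sigma>. [x = b] (mod m) \<and> b \<le> x) \<and>
     \<rho> = (if \<gamma> = [] then [] else replicate (length \<sigma>) (m * length \<gamma>))}"

definition copartition_size :: "nat list \<times> nat list \<times> nat list \<Rightarrow> nat" where
  "copartition_size = (\<lambda>(\<gamma>, \<rho>, \<sigma>). sum_list \<gamma> + sum_list \<rho> + sum_list \<sigma>)"

definition cp_odd :: "nat \<Rightarrow> nat \<Rightarrow> nat \<Rightarrow> nat \<Rightarrow> nat" where
  "cp_odd a b m n =
     card {c \<in> copartitions a b m. copartition_size c = n \<and> odd (length (fst c))}"

definition cp_even :: "nat \<Rightarrow> nat \<Rightarrow> nat \<Rightarrow> nat \<Rightarrow> nat" where
  "cp_even a b m n =
     card {c \<in> copartitions a b m. copartition_size c = n \<and> even (length (fst c))}"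

text \<open>The infinite product is a limit of formal power series, i.e. coefficientwise; it
  exists whenever \<open>x\<close> and \<open>q\<close> have zero constant coefficient.\<close>

definition qpochhammer_inf :: "'a::field fps \<Rightarrow> 'a fps \<Rightarrow> 'a fps" where
  "qpochhammer_inf x q = (\<Prod>k. 1 - x * q ^ k)"

lemma finite_copartitions_size: "finite {c \<in> copartitions a b m. copartition_size c = n}"
proof -
  define L where "L = {xs :: nat list. set xs \<subseteq> {..n} \<and> length xs \<le> n}"
  have L: "xs \<in> L" if "int_partition xs" "sum_list xs \<le> n" for xs
  proof -
    have "length xs \<le> sum_list xs"
      using that(1) unfolding int_partition_def by (induction xs) auto
    moreover have "x \<le> sum_list xs" if "x \<in> set xs" for x
      using that by (intro member_le_sum_list) auto
    ultimately show ?thesis using that(2) unfolding L_def by fastforce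
  qed
  have "finite L" unfolding L_def by (rule finite_lists_length_le) auto
  moreover have "{c \<in> copartitions a b m. copartition_size c = n} \<subseteq> L \<times> L \<times> L"
    by (auto simp: copartitions_def copartition_size_def simp del: sum_list_replicate intro!: L)
  ultimately show ?thesis
    by (meson finite_SigmaI finite_subset)
qed

lemma qpochhammer_inf_has_prod:
  fixes x q :: "'a::field fps"
  assumes x: "fps_nth x 0 = 0" and q: "fps_nth q 0 = 0"
  shows "(\<lambda>k. 1 - x * q ^ k) has_prod qpochhammer_inf x q"
proof -
  define P where "P = (\<lambda>n. \<Prod>k\<le>n. 1 - x * q ^ k)"
  define L where "L = Abs_fps (\<lambda>n. fps_nth (P n) n)"
  have low: "fps_nth (y * q ^ k) n = 0" if "n < k" for n k and y :: "'a fps"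
    using that q by (auto simp: fps_mult_nth startsby_zero_power_prefix)
  have step: "fps_nth (P (Suc k)) n = fps_nth (P k) n" if "n \<le> k" for n k
  proof -
    have "P (Suc k) = P k - (P k * x) * q ^ Suc k"
      by (simp add: P_def algebra_simps)
    thus ?thesis using low[of n "Suc k" "P k * x"] that by simp
  qed
  have const: "fps_nth (P k) n = fps_nth L n" if "n \<le> k" for n k
    using that by (induction k rule: dec_induct) (auto simp: L_def step)
  have lim: "P \<longlonglongrightarrow> L"
    by (rule tendsto_fpsI) (use const in \<open>auto simp: eventually_at_top_linorder\<close>)
  have "fps_nth L 0 = 1"
    using x by (simp add: L_def P_def)
  hence "L \<noteq> 0" by auto
  hence raw: "(\<lambda>k. 1 - x * q ^ k) has_prod L"
    using lim by (simp add: has_prod_def raw_has_prod_def P_def)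
  have nz: "1 - x * q ^ k \<noteq> 0" for k
  proof
    assume "1 - x * q ^ k = 0"
    hence "fps_nth (1 - x * q ^ k) 0 = 0" by (simp only: fps_zero_nth)
    thus False using x by simp
  qed
  have "p = L" if "(\<lambda>k. 1 - x * q ^ k) has_prod p" for p
  proof -
    have "P \<longlonglongrightarrow> p"
      using that nz unfolding has_prod_def raw_has_prod_def P_def add_0_right by blast
    thus ?thesis using lim by (rule LIMSEQ_unique)
  qed
  hence "qpochhammer_inf x q = L"
    unfolding qpochhammer_inf_def prodinf_def by (intro the_equality raw)
  thus ?thesis using raw by (simp only:)
qed

end

theory Submission
  imports Defs
begin

text \<open>Consider the series \<open>F\<^bsub>j,k\<^esub>\<close> in which a ground \<open>\<gamma>\<close> with \<open>r\<close> parts and a sky \<open>\<sigma>\<close> with \<open>s\<close>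
  parts have the weight \<open>x\<^sup>r y\<^sup>s\<close> and the size \<open>|\<gamma>| + |\<sigma>| + m(rs + jr + ks)\<close>; copartitions are the case
  \<open>j = k = 0\<close>. According to whether \<open>b\<close> is a part of the sky, and \<open>a\<close> one of the ground,
  \<open>F\<^bsub>j,k\<^esub> = F\<^bsub>j,k+1\<^esub> + y v F\<^bsub>j+1,k\<^esub>\<close> and \<open>F\<^bsub>j,k\<^esub> = F\<^bsub>j+1,k\<^esub> + x u F\<^bsub>j,k+1\<^esub>\<close> with \<open>u = q\<close> to the power
  \<open>a + mj\<close> and \<open>v = q\<close> to the power \<open>b + mk\<close>. Eliminating,
  \<open>(1 - y v) F\<^bsub>j,k\<^esub> = (1 - x y u v) F\<^bsub>j,k+1\<^esub>\<close>, and symmetrically in \<open>j\<close>. Iterating along the diagonal,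
  where \<open>F\<^bsub>k,k\<^esub>\<close> tends to \<open>1\<close>, gives the product formula. For \<open>x = -1\<close>, \<open>y = 1\<close> and \<open>a = b\<close> the
  denominator factors combine to \<open>1 - u\<^sup>2\<close> and the numerator factors are \<open>1 + u v\<close>, so that all
  coefficients are visibly non-negative.\<close>

section \<open>Partitions into parts of an arithmetic progression\<close>

definition ap_partitions :: "nat \<Rightarrow> nat \<Rightarrow> nat list set" where
  "ap_partitions a m = {xs. sorted_wrt (\<ge>) xs \<and> (\<forall>x\<in>set xs. [x = a] (mod m) \<and> a \<le> x)}"

lemma Nil_in_ap_partitions [simp]: "[] \<in> ap_partitions a m"
  by (simp add: ap_partitions_def)

lemma map_add_in_ap_partitions:
  "xs \<in> ap_partitions a m \<Longrightarrow> map (\<lambda>x. x + m) xs \<in> ap_partitions a m"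
  by (auto simp: ap_partitions_def sorted_wrt_map cong_def)

lemma append_in_ap_partitions:
  "xs \<in> ap_partitions a m \<Longrightarrow> xs @ [a] \<in> ap_partitions a m"
  by (auto simp: ap_partitions_def sorted_wrt_append)

text \<open>The parts are non-increasing, so \<open>a\<close> can be taken as the last one if it
  occurs at all. If it does not occur, every part is at least \<open>a + m\<close>, and lowering all
  parts by \<open>m\<close> stays in the set. This dichotomy is the source of both
  recurrences.\<close>

lemma ap_partitions_cases:
  assumes "xs \<in> ap_partitions a m"
  obtains ys where "ys \<in> ap_partitions a m" "xs = ys @ [a]"
        | ys where "ys \<in> ap_partitions a m" "xs = map (\<lambda>x. x + m) ys"
proof (cases "a \<in> set xs")
  case True
  then obtain ys z where xs: "xs = ys @ [z]"
    by (metis empty_iff empty_set rev_exhaust)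
  with assms True have "z = a"
    by (force simp: ap_partitions_def sorted_wrt_append)
  moreover have "ys \<in> ap_partitions a m"
    using assms xs by (auto simp: ap_partitions_def sorted_wrt_append)
  ultimately show ?thesis using that(1) xs by blast
next
  case False
  have ge: "a + m \<le> x" and cg: "[x - m = a] (mod m)" if "x \<in> set xs" for x
  proof -
    have x: "[x = a] (mod m)" "a \<le> x" "x \<noteq> a"
      using assms False that by (auto simp: ap_partitions_def)
    then obtain i where i: "x = a + i * m"
      by (metis cong_le_nat cong_sym add.commute mult.commute)
    with x have "i > 0" by (cases i) auto
    then obtain l where "i = Suc l" by (cases i) auto
    with i show "a + m \<le> x" "[x - m = a] (mod m)"
      by (auto simp: cong_def)
  qed
  \<comment> \<open>Truncated subtraction is monotone, so the order survives without any bound. The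
    bound \<open>ge\<close> is what keeps the lowered parts at least \<open>a\<close> and makes the
    lowering invertible.\<close>
  have "sorted_wrt (\<lambda>x y. x - m \<ge> y - m) xs"
    using assms by (auto simp: ap_partitions_def elim!: sorted_wrt_mono_rel[rotated])
  hence "map (\<lambda>x. x - m) xs \<in> ap_partitions a m"
    using ge cg by (fastforce simp: ap_partitions_def sorted_wrt_map)
  moreover have "xs = map (\<lambda>x. x + m) (map (\<lambda>x. x - m) xs)"
    using ge by (force intro: map_idI[symmetric])
  ultimately show ?thesis using that(2) by blast
qed

section \<open>Copartitions as pairs of ground and sky\<close>

lemma ap_partitions_int_partition:
  assumes "a \<ge> 1"
  shows "xs \<in> ap_partitions a m \<longleftrightarrow>
    int_partition xs \<and> (\<forall>x\<in>set xs. [x = a] (mod m) \<and> a \<le> x)"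
  using assms by (fastforce simp: ap_partitions_def int_partition_def)

text \<open>The component \<open>\<rho>\<close> is determined by the other two and survives only as
  the product of the lengths. Adding \<open>m * j\<close> to every ground part and
  \<open>m * k\<close> to every sky part identifies these pairs with the copartitions for
  \<open>a + m * j\<close>, \<open>b + m * k\<close> and \<open>m\<close>.\<close>

definition shifted_pairs :: "nat \<Rightarrow> nat \<Rightarrow> nat \<Rightarrow> nat \<Rightarrow> nat \<Rightarrow> nat \<Rightarrow> (nat list \<times> nat list) set" where
  "shifted_pairs a b m j k n = {(\<gamma>, \<sigma>). \<gamma> \<in> ap_partitions a m \<and> \<sigma> \<in> ap_partitions b m \<and>
     sum_list \<gamma> + sum_list \<sigma> +
       m * (length \<gamma> * length \<sigma> + j * length \<gamma> + k * length \<sigma>) = n}"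

definition weight :: "'a::comm_monoid_mult \<Rightarrow> 'a \<Rightarrow> nat list \<times> nat list \<Rightarrow> 'a" where
  "weight x y = (\<lambda>(\<gamma>, \<sigma>). x ^ length \<gamma> * y ^ length \<sigma>)"

definition pair_series ::
    "'a::comm_ring_1 \<Rightarrow> 'a \<Rightarrow> nat \<Rightarrow> nat \<Rightarrow> nat \<Rightarrow> nat \<Rightarrow> nat \<Rightarrow> 'a fps" where
  "pair_series x y a b m j k = Abs_fps (\<lambda>n. sum (weight x y) (shifted_pairs a b m j k n))"

lemma pair_of_copartition_bij:
  assumes "a \<ge> 1" "b \<ge> 1" "m \<ge> 1"
  shows "bij_betw (\<lambda>(\<gamma>, \<rho>, \<sigma>). (\<gamma>, \<sigma>)) {c \<in> copartitions a b m. copartition_size c = n}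
    (shifted_pairs a b m 0 0 n)"
  unfolding bij_betw_def
proof
  show "inj_on (\<lambda>(\<gamma>, \<rho>, \<sigma>). (\<gamma>, \<sigma>)) {c \<in> copartitions a b m. copartition_size c = n}"
    by (auto simp: inj_on_def copartitions_def)
  \<comment> \<open>As \<open>m\<close> is positive, \<open>m * length \<gamma>\<close> is positive
    for nonempty \<open>\<gamma>\<close>, so the \<open>\<rho>\<close> rebuilt from a pair is a
    partition.\<close>
  have rho: "int_partition (if \<gamma> = [] then [] else replicate l (m * length \<gamma>))"
    for \<gamma> :: "nat list" and l
    using assms by (auto simp: int_partition_def sorted_wrt_iff_nth_less)
  show "(\<lambda>(\<gamma>, \<rho>, \<sigma>). (\<gamma>, \<sigma>)) ` {c \<in> copartitions a b m. copartition_size c = n} =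
      shifted_pairs a b m 0 0 n" (is "?l = ?r")
  proof
    show "?l \<subseteq> ?r"
      using assms by (auto simp: shifted_pairs_def copartitions_def copartition_size_def
          ap_partitions_int_partition sum_list_replicate split: if_splits)
    show "?r \<subseteq> ?l"
    proof
      fix p assume p: "p \<in> ?r"
      obtain \<gamma> \<sigma> where [simp]: "p = (\<gamma>, \<sigma>)" by (cases p)
      let ?\<rho> = "if \<gamma> = [] then [] else replicate (length \<sigma>) (m * length \<gamma>)"
      have "(\<gamma>, ?\<rho>, \<sigma>) \<in> copartitions a b m" "copartition_size (\<gamma>, ?\<rho>, \<sigma>) = n"
        using p rho[of \<gamma> "length \<sigma>"] assms
        by (auto simp: shifted_pairs_def copartitions_def copartition_size_def
            ap_partitions_int_partition sum_list_replicate)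
      thus "p \<in> ?l" by force
    qed
  qed
qed

lemma finite_shifted_pairs:
  assumes "a \<ge> 1" "b \<ge> 1" "m \<ge> 1"
  shows "finite (shifted_pairs a b m j k n)"
proof (rule finite_subset)
  \<comment> \<open>Dropping the shifts can only decrease the size.\<close>
  show "shifted_pairs a b m j k n \<subseteq> (\<Union>i\<le>n. shifted_pairs a b m 0 0 i)"
    by (auto simp: shifted_pairs_def algebra_simps)
  show "finite (\<Union>i\<le>n. shifted_pairs a b m 0 0 i)"
    using bij_betw_finite[OF pair_of_copartition_bij[OF assms]] finite_copartitions_size by auto
qed

section \<open>Recurrences in the shifts\<close>

lemma pair_series_swap: "pair_series x y a b m j k = pair_series y x b a m k j"
proof (rule fps_ext)
  fix n
  have "bij_betw prod.swap (shifted_pairs a b m j k n) (shifted_pairs b a m k j n)"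
    by (rule bij_betwI[where g = prod.swap]) (auto simp: shifted_pairs_def algebra_simps)
  thus "fps_nth (pair_series x y a b m j k) n = fps_nth (pair_series y x b a m k j) n"
    unfolding pair_series_def fps_nth_Abs_fps
    by (subst sum.reindex_bij_betw[symmetric])
      (auto simp: weight_def mult.commute intro!: sum.cong)
qed

text \<open>Lowering each of the \<open>s\<close> sky parts by \<open>m\<close> frees
  \<open>m * s\<close>, which raises \<open>k\<close> by one. Removing a sky part \<open>b\<close>
  lowers the size by \<open>b + m * k\<close> and by \<open>m\<close> for each ground part; the
  latter amount is absorbed by raising \<open>j\<close>.\<close>

lemma shifted_pairs_sky_cases:
  "shifted_pairs a b m j k n =
     map_prod id (map (\<lambda>x. x + m)) ` shifted_pairs a b m j (Suc k) n \<union>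
     (if n < b + m * k then {}
      else map_prod id (\<lambda>\<sigma>. \<sigma> @ [b]) ` shifted_pairs a b m (Suc j) k (n - (b + m * k)))"
  (is "?l = ?A \<union> ?B")
proof (intro subset_antisym subsetI)
  fix p assume p: "p \<in> ?l"
  obtain \<gamma> \<sigma> where [simp]: "p = (\<gamma>, \<sigma>)" by (cases p)
  have \<gamma>: "\<gamma> \<in> ap_partitions a m" and "\<sigma> \<in> ap_partitions b m"
    using p by (auto simp: shifted_pairs_def)
  from this(2) show "p \<in> ?A \<union> ?B"
  proof (cases rule: ap_partitions_cases)
    case (1 \<tau>)
    with p \<gamma> have le: "b + m * k \<le> n"
      and "(\<gamma>, \<tau>) \<in> shifted_pairs a b m (Suc j) k (n - (b + m * k))"
      by (auto simp: shifted_pairs_def algebra_simps)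
    from this(2) have "map_prod id (\<lambda>\<sigma>. \<sigma> @ [b]) (\<gamma>, \<tau>) \<in>
        map_prod id (\<lambda>\<sigma>. \<sigma> @ [b]) ` shifted_pairs a b m (Suc j) k (n - (b + m * k))"
      by (rule imageI)
    with 1 le show ?thesis by simp
  next
    case (2 \<tau>)
    with p \<gamma> have "(\<gamma>, \<tau>) \<in> shifted_pairs a b m j (Suc k) n"
      by (auto simp: shifted_pairs_def algebra_simps sum_list_addf sum_list_triv)
    moreover have "p = map_prod id (map (\<lambda>x. x + m)) (\<gamma>, \<tau>)" using 2 by simp
    ultimately show ?thesis by blast
  qed
next
  fix p assume "p \<in> ?A \<union> ?B"
  thus "p \<in> ?l"
    by (auto simp: shifted_pairs_def algebra_simps sum_list_addf sum_list_triv
        map_add_in_ap_partitions[unfolded add.commute[of _ m]] append_in_ap_partitions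
        split: if_splits)
qed

lemma pair_series_sky_rec:
  assumes "a \<ge> 1" "b \<ge> 1" "m \<ge> 1"
  shows "pair_series x y a b m j k = pair_series x y a b m j (Suc k) +
    fps_const y * fps_X ^ (b + m * k) * pair_series x y a b m (Suc j) k"
proof (rule fps_ext)
  fix n
  define A where "A = map_prod id (map (\<lambda>x. x + m)) ` shifted_pairs a b m j (Suc k) n"
  define B where "B = (if n < b + m * k then {}
      else map_prod id (\<lambda>\<sigma>. \<sigma> @ [b]) ` shifted_pairs a b m (Suc j) k (n - (b + m * k)))"
  have disj: "A \<inter> B = {}"
  proof -
    \<comment> \<open>After the shift all parts are at least \<open>b + m\<close>, which exceeds
      \<open>b\<close> because \<open>m\<close> is positive.\<close>
    have "b \<notin> set (map (\<lambda>x. x + m) \<tau>)" if "\<tau> \<in> ap_partitions b m" for \<tau>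
      using that assms by (force simp: ap_partitions_def)
    moreover have "b \<in> set (\<tau> @ [b])" for \<tau> by simp
    ultimately have "map (\<lambda>x. x + m) \<tau> \<noteq> \<tau>' @ [b]" if "\<tau> \<in> ap_partitions b m" for \<tau> \<tau>'
      using that by metis
    thus ?thesis unfolding A_def B_def by (auto simp: shifted_pairs_def)
  qed
  have fin: "finite A" "finite B"
    using finite_shifted_pairs[OF assms] by (auto simp: A_def B_def)
  have "inj (map_prod id (map (\<lambda>x. x + m)) :: nat list \<times> nat list \<Rightarrow> _)"
    by (intro prod.inj_map list.inj_map) (auto simp: inj_def)
  hence A: "sum (weight x y) A = sum (weight x y) (shifted_pairs a b m j (Suc k) n)"
    unfolding A_def by (subst sum.reindex) (auto simp: weight_def inj_on_def intro!: sum.cong)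
  have "inj (map_prod id (\<lambda>\<sigma>. \<sigma> @ [b]) :: nat list \<times> nat list \<Rightarrow> _)"
    by (intro prod.inj_map) (auto simp: inj_def)
  hence B: "sum (weight x y) B = (if n < b + m * k then 0
      else y * sum (weight x y) (shifted_pairs a b m (Suc j) k (n - (b + m * k))))"
    unfolding B_def
    by (auto simp: sum.reindex[OF inj_on_subset] sum_distrib_left weight_def algebra_simps
        intro!: sum.cong)
  have "sum (weight x y) (shifted_pairs a b m j k n) = sum (weight x y) A + sum (weight x y) B"
    unfolding A_def[symmetric] B_def[symmetric] shifted_pairs_sky_cases[of a b m j k n]
    using fin disj by (rule sum.union_disjoint)
  thus "fps_nth (pair_series x y a b m j k) n = fps_nth (pair_series x y a b m j (Suc k) +
      fps_const y * fps_X ^ (b + m * k) * pair_series x y a b m (Suc j) k) n"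
    by (simp add: pair_series_def A B fps_X_power_mult_nth mult.assoc)
qed

text \<open>Exchanging ground and sky turns the sky recurrence into this one.\<close>

lemma pair_series_ground_rec:
  assumes "a \<ge> 1" "b \<ge> 1" "m \<ge> 1"
  shows "pair_series x y a b m j k = pair_series x y a b m (Suc j) k +
    fps_const x * fps_X ^ (a + m * j) * pair_series x y a b m j (Suc k)"
  using pair_series_sky_rec[of b a m y x k j] assms
  by (simp add: pair_series_swap[of y x])

lemma pair_series_step_sky:
  assumes "a \<ge> 1" "b \<ge> 1" "m \<ge> 1"
  shows "(1 - fps_const y * fps_X ^ (b + m * k)) * pair_series x y a b m j k =
    (1 - fps_const (x * y) * fps_X ^ (a + b + m * (j + k))) * pair_series x y a b m j (Suc k)"
proof -
  define F G H u v where "F = pair_series x y a b m j k" and "G = pair_series x y a b m j (Suc k)"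
    and "H = pair_series x y a b m (Suc j) k"
    and "u = fps_const x * fps_X ^ (a + m * j)" and "v = fps_const y * fps_X ^ (b + m * k)"
  have sky: "F = G + v * H" and ground: "F = H + u * G"
    unfolding F_def G_def H_def u_def v_def
    by (rule pair_series_sky_rec pair_series_ground_rec; fact)+
  \<comment> \<open>Subtracting \<open>v\<close> times \<open>ground\<close> from \<open>sky\<close>
    cancels the term \<open>v * H\<close>.\<close>
  have "(1 - v) * F = F - v * F" by (simp add: left_diff_distrib)
  also have "v * F = v * H + u * v * G" by (subst ground) (simp add: algebra_simps)
  also have "F - (v * H + u * v * G) = (1 - u * v) * G" by (subst sky) (simp add: algebra_simps)
  finally have "(1 - v) * F = (1 - u * v) * G" .
  moreover have "u * v = fps_const (x * y) * fps_X ^ (a + b + m * (j + k))"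
    by (simp add: u_def v_def algebra_simps power_add flip: fps_const_mult)
  ultimately show ?thesis by (simp add: F_def G_def v_def)
qed

lemma pair_series_step_ground:
  assumes "a \<ge> 1" "b \<ge> 1" "m \<ge> 1"
  shows "(1 - fps_const x * fps_X ^ (a + m * j)) * pair_series x y a b m j k =
    (1 - fps_const (x * y) * fps_X ^ (a + b + m * (j + k))) * pair_series x y a b m (Suc j) k"
  using pair_series_step_sky[of b a m x j y k] assms
  by (simp add: pair_series_swap[of y x] algebra_simps)

section \<open>Iteration along the diagonal\<close>

lemma pair_series_diagonal:
  assumes "a \<ge> 1" "b \<ge> 1" "m \<ge> 1"
  shows "(\<Prod>k<K. 1 - fps_const x * fps_X ^ (a + m * k)) *
      (\<Prod>k<K. 1 - fps_const y * fps_X ^ (b + m * k)) * pair_series x y a b m 0 0 =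
    (\<Prod>k<2*K. 1 - fps_const (x * y) * fps_X ^ (a + b + m * k)) * pair_series x y a b m K K"
proof (induction K)
  case (Suc K)
  define P Q R where "P = (\<Prod>k<K. 1 - fps_const x * fps_X ^ (a + m * k))"
    and "Q = (\<Prod>k<K. 1 - fps_const y * fps_X ^ (b + m * k))"
    and "R = (\<Prod>k<2*K. 1 - fps_const (x * y) * fps_X ^ (a + b + m * k))"
  define p q r r' where "p = 1 - fps_const x * fps_X ^ (a + m * K)"
    and "q = 1 - fps_const y * fps_X ^ (b + m * K)"
    and "r = 1 - fps_const (x * y) * fps_X ^ (a + b + m * (2 * K))"
    and "r' = 1 - fps_const (x * y) * fps_X ^ (a + b + m * Suc (2 * K))"
  define F where "F = pair_series x y a b m"
  have IH: "P * Q * F 0 0 = R * F K K" using Suc.IH by (simp add: P_def Q_def R_def F_def)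
  \<comment> \<open>A diagonal step raises \<open>k\<close> while the shifts sum to
    \<open>2 * K\<close>, then \<open>j\<close> while they sum to \<open>2 * K + 1\<close>. Hence it
    yields two consecutive numerator factors, but only one factor of each denominator
    product.\<close>
  have sky: "q * F K K = r * F K (Suc K)"
    using pair_series_step_sky[OF assms, of y K x K] by (simp add: q_def r_def F_def mult_2)
  have ground: "p * F K (Suc K) = r' * F (Suc K) (Suc K)"
    using pair_series_step_ground[OF assms, of x K y "Suc K"]
    by (simp add: p_def r'_def F_def mult_2)
  have "(P * p) * (Q * q) * F 0 0 = p * q * (P * Q * F 0 0)" by (simp only: ac_simps)
  also have "\<dots> = R * p * (q * F K K)" unfolding IH by (simp only: ac_simps)
  also have "\<dots> = R * r * (p * F K (Suc K))" unfolding sky by (simp only: ac_simps)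
  also have "\<dots> = (R * r * r') * F (Suc K) (Suc K)" unfolding ground by (simp only: ac_simps)
  finally have "(P * p) * (Q * q) * F 0 0 = (R * r * r') * F (Suc K) (Suc K)" .
  thus ?case
    by (simp add: P_def Q_def R_def p_def q_def r_def r'_def F_def)
qed simp

text \<open>Any part, in ground or sky, adds at least \<open>m * K\<close> to the size, which
  exceeds \<open>n\<close>. Only the empty pair remains.\<close>

lemma fps_nth_pair_series_diagonal:
  assumes "n < K" "m \<ge> 1"
  shows "fps_nth (pair_series x y a b m K K) n = (if n = 0 then 1 else 0)"
proof -
  have "shifted_pairs a b m K K n = (if n = 0 then {([], [])} else {})"
  proof -
    have "\<gamma> = [] \<and> \<sigma> = []" if "(\<gamma>, \<sigma>) \<in> shifted_pairs a b m K K n" for \<gamma> \<sigma>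
    proof -
      have "1 * (K * (length \<gamma> + length \<sigma>)) \<le> m * (length \<gamma> * length \<sigma> + K * length \<gamma> + K * length \<sigma>)"
        using assms(2) by (intro mult_le_mono) (auto simp: algebra_simps)
      also have "\<dots> \<le> n" using that by (auto simp: shifted_pairs_def)
      also have "n < K * 1" using assms(1) by simp
      finally have "length \<gamma> + length \<sigma> < 1" by (simp only: mult_1 mult_less_cancel1)
      thus ?thesis by simp
    qed
    moreover have "([], []) \<in> shifted_pairs a b m K K n \<longleftrightarrow> n = 0"
      by (auto simp: shifted_pairs_def)
    ultimately show ?thesis by auto
  qed
  thus ?thesis by (simp add: pair_series_def weight_def)
qed

section \<open>Coefficientwise limits and the product formula\<close>

lemma tendsto_mult_fps:
  fixes f g :: "'b \<Rightarrow> 'a::ring fps"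
  assumes "(f \<longlongrightarrow> A) F" "(g \<longlongrightarrow> B) F"
  shows "((\<lambda>z. f z * g z) \<longlongrightarrow> A * B) F"
proof (rule tendsto_fpsI)
  fix n
  \<comment> \<open>Coefficient \<open>n\<close> of a product involves only the coefficients up to
    \<open>n\<close> of the factors, and each of these finitely many is eventually constant.\<close>
  have "eventually (\<lambda>z. \<forall>i\<in>{..n}. fps_nth (f z) i = fps_nth A i \<and> fps_nth (g z) i = fps_nth B i) F"
    using assms unfolding tendsto_fps_iff
    by (intro eventually_ball_finite ballI eventually_conj) auto
  thus "eventually (\<lambda>z. fps_nth (f z * g z) n = fps_nth (A * B) n) F"
    by eventually_elim (auto simp: fps_mult_nth intro!: sum.cong)
qed

lemma qpochhammer_inf_monom_tendsto:
  fixes x :: "'a::field"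
  assumes "c \<ge> 1" "m \<ge> 1"
  shows "(\<lambda>K. \<Prod>k<K. 1 - fps_const x * fps_X ^ (c + m * k)) \<longlonglongrightarrow>
    qpochhammer_inf (fps_const x * fps_X ^ c) (fps_X ^ m)"
  using has_prod_imp_tendsto'[OF qpochhammer_inf_has_prod
      [of "fps_const x * fps_X ^ c" "fps_X ^ m"]] assms
  by (simp add: power_add power_mult mult.assoc)

lemma fps_nth_0_qpochhammer_inf:
  fixes x q :: "'a::field fps"
  assumes "fps_nth x 0 = 0" "fps_nth q 0 = 0"
  shows "fps_nth (qpochhammer_inf x q) 0 = 1"
proof -
  have "fps_nth (\<Prod>k<K. 1 - x * q ^ k) 0 = 1" for K
    using assms by (induction K) auto
  moreover have "eventually (\<lambda>K. fps_nth (\<Prod>k<K. 1 - x * q ^ k) 0 =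
      fps_nth (qpochhammer_inf x q) 0) sequentially"
    using has_prod_imp_tendsto'[OF qpochhammer_inf_has_prod[OF assms]]
    unfolding tendsto_fps_iff by blast
  ultimately show ?thesis by simp
qed

text \<open>Both sides are limits of one sequence, since \<open>pair_series_diagonal\<close> equates
  its two forms for every \<open>K\<close>.\<close>

lemma pair_series_product:
  fixes x y :: "'a::field"
  assumes "a \<ge> 1" "b \<ge> 1" "m \<ge> 1"
  shows "qpochhammer_inf (fps_const x * fps_X ^ a) (fps_X ^ m) *
      qpochhammer_inf (fps_const y * fps_X ^ b) (fps_X ^ m) * pair_series x y a b m 0 0 =
    qpochhammer_inf (fps_const (x * y) * fps_X ^ (a + b)) (fps_X ^ m)"
proof (rule LIMSEQ_unique)
  \<comment> \<open>The numerator has \<open>2 * K\<close> factors, so its limit is taken along a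
    subsequence of the partial products.\<close>
  have "strict_mono (\<lambda>K::nat. 2 * K)" by (auto simp: strict_mono_def)
  hence "(\<lambda>K. \<Prod>k<2*K. 1 - fps_const (x * y) * fps_X ^ (a + b + m * k)) \<longlonglongrightarrow>
      qpochhammer_inf (fps_const (x * y) * fps_X ^ (a + b)) (fps_X ^ m)"
    using LIMSEQ_subseq_LIMSEQ[OF qpochhammer_inf_monom_tendsto[of "a + b" m "x * y"]] assms
    by (simp add: o_def)
  moreover have "(\<lambda>K. pair_series x y a b m K K) \<longlonglongrightarrow> 1"
  proof (rule tendsto_fpsI)
    fix n
    show "eventually (\<lambda>K. fps_nth (pair_series x y a b m K K) n = fps_nth 1 n) sequentially"
      using eventually_gt_at_top[of n]
      by eventually_elim (use assms in \<open>simp add: fps_nth_pair_series_diagonal\<close>)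
  qed
  ultimately show "(\<lambda>K. (\<Prod>k<2*K. 1 - fps_const (x * y) * fps_X ^ (a + b + m * k)) *
      pair_series x y a b m K K) \<longlonglongrightarrow>
      qpochhammer_inf (fps_const (x * y) * fps_X ^ (a + b)) (fps_X ^ m)"
    using tendsto_mult_fps by fastforce
  show "(\<lambda>K. (\<Prod>k<2*K. 1 - fps_const (x * y) * fps_X ^ (a + b + m * k)) *
      pair_series x y a b m K K) \<longlonglongrightarrow>
      qpochhammer_inf (fps_const x * fps_X ^ a) (fps_X ^ m) *
      qpochhammer_inf (fps_const y * fps_X ^ b) (fps_X ^ m) * pair_series x y a b m 0 0"
    unfolding pair_series_diagonal[OF assms, symmetric]
    by (intro tendsto_mult_fps tendsto_const qpochhammer_inf_monom_tendsto assms)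
qed

section \<open>Non-negative coefficients\<close>

lemma fps_mult_nth_nonneg:
  fixes f g :: "'a::linordered_idom fps"
  assumes "\<And>i. i \<le> n \<Longrightarrow> 0 \<le> fps_nth f i" "\<And>i. i \<le> n \<Longrightarrow> 0 \<le> fps_nth g i"
  shows "0 \<le> fps_nth (f * g) n"
  by (auto simp: fps_mult_nth assms intro!: sum_nonneg mult_nonneg_nonneg)

lemma fps_nth_prod_nonneg:
  fixes f :: "'b \<Rightarrow> 'a::linordered_idom fps"
  assumes "\<And>k n. k \<in> A \<Longrightarrow> 0 \<le> fps_nth (f k) n"
  shows "0 \<le> fps_nth (prod f A) n"
  using assms
  by (induction A arbitrary: n rule: infinite_finite_induct) (auto intro!: fps_mult_nth_nonneg)

text \<open>Coefficient \<open>i\<close> of \<open>f\<close> is that of the product plus, if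
  \<open>d \<le> i\<close>, coefficient \<open>i - d\<close> of \<open>f\<close>, so strong
  induction applies. The cutoff \<open>n\<close> is there because the diagonal series is controlled
  only below \<open>K\<close>.\<close>

lemma fps_nth_nonneg_cancel:
  fixes f :: "'a::linordered_idom fps"
  assumes "d \<ge> 1" and nonneg: "\<And>i. i \<le> n \<Longrightarrow> 0 \<le> fps_nth ((1 - fps_X ^ d) * f) i" and "i \<le> n"
  shows "0 \<le> fps_nth f i"
  using \<open>i \<le> n\<close>
proof (induction i rule: less_induct)
  case (less i)
  have "0 \<le> fps_nth f (i - d)" if "d \<le> i"
    using that less assms(1) by simp
  with nonneg[OF less.prems] show ?case
    by (auto simp: left_diff_distrib fps_X_power_mult_nth split: if_splits)
qed

lemma fps_nth_nonneg_cancel_prod: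
  fixes f :: "'a::linordered_idom fps" and K :: nat
  assumes "\<forall>k<K. d k \<ge> 1"
    and "\<forall>i\<le>n. 0 \<le> fps_nth ((\<Prod>k<K. 1 - fps_X ^ d k) * f) i"
  shows "\<forall>i\<le>n. 0 \<le> fps_nth f i"
  using assms
proof (induction K arbitrary: f)
  case (Suc K)
  have "\<forall>i\<le>n. 0 \<le> fps_nth ((1 - fps_X ^ d K) * f) i"
  proof (rule Suc.IH)
    show "\<forall>k<K. d k \<ge> 1" using Suc.prems(1) by simp
    show "\<forall>i\<le>n. 0 \<le> fps_nth ((\<Prod>k<K. 1 - fps_X ^ d k) * ((1 - fps_X ^ d K) * f)) i"
      using Suc.prems(2) by (simp only: prod.lessThan_Suc mult.assoc)
  qed
  moreover have "d K \<ge> 1" using Suc.prems(1) by simp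
  ultimately show ?case by (intro allI impI fps_nth_nonneg_cancel[of "d K" n f]) auto
qed simp

lemma pair_series_signed_nonneg:
  assumes "a \<ge> 1" "m \<ge> 1"
  shows "0 \<le> fps_nth (pair_series (- 1 :: rat) 1 a a m 0 0) n"
proof -
  \<comment> \<open>The least \<open>K\<close> for which the series at shifts \<open>K\<close>,
    \<open>K\<close> is known to agree with 1 up to coefficient \<open>n\<close>. The argument thus
    needs only finite products.\<close>
  define K where "K = Suc n"
  have "(1 - fps_const (- 1) * fps_X ^ (a + m * k)) * (1 - fps_const 1 * fps_X ^ (a + m * k)) =
      1 - (fps_X :: rat fps) ^ (2 * (a + m * k))" for k
    by (simp add: algebra_simps flip: fps_const_neg power_add mult_2)
  hence "(\<Prod>k<K. 1 - (fps_X :: rat fps) ^ (2 * (a + m * k))) * pair_series (- 1) 1 a a m 0 0 =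
      (\<Prod>k<2*K. 1 + fps_X ^ (a + a + m * k)) * pair_series (- 1) 1 a a m K K"
    using pair_series_diagonal[of a a m "- 1 :: rat" K 1] assms
    by (simp flip: prod.distrib fps_const_neg)
  moreover have "0 \<le> fps_nth ((\<Prod>k<2*K. 1 + (fps_X :: rat fps) ^ (a + a + m * k)) *
      pair_series (- 1) 1 a a m K K) i" if "i \<le> n" for i
  proof (rule fps_mult_nth_nonneg)
    show "0 \<le> fps_nth (\<Prod>k<2*K. 1 + (fps_X :: rat fps) ^ (a + a + m * k)) l" for l
      by (rule fps_nth_prod_nonneg) simp
    show "0 \<le> fps_nth (pair_series (- 1 :: rat) 1 a a m K K) l" if "l \<le> i" for l
      using that \<open>i \<le> n\<close> assms(2) by (simp add: fps_nth_pair_series_diagonal K_def)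
  qed
  ultimately show ?thesis
    using fps_nth_nonneg_cancel_prod[of K "\<lambda>k. 2 * (a + m * k)" n
        "pair_series (- 1 :: rat) 1 a a m 0 0"] assms
    by simp
qed

section \<open>The signed count and the two claims\<close>

lemma fps_nth_pair_series_signed:
  assumes "a \<ge> 1" "b \<ge> 1" "m \<ge> 1"
  shows "fps_nth (pair_series (- 1 :: 'a::comm_ring_1) 1 a b m 0 0) n =
    of_nat (cp_even a b m n) - of_nat (cp_odd a b m n)"
proof -
  define C where "C = {c \<in> copartitions a b m. copartition_size c = n}"
  have fin: "finite C" unfolding C_def by (rule finite_copartitions_size)
  have "fps_nth (pair_series (- 1 :: 'a) 1 a b m 0 0) n =
      (\<Sum>c\<in>C. weight (- 1) 1 ((\<lambda>(\<gamma>, \<rho>, \<sigma>). (\<gamma>, \<sigma>)) c))"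
    unfolding pair_series_def fps_nth_Abs_fps C_def
    by (rule sum.reindex_bij_betw[OF pair_of_copartition_bij[OF assms], symmetric])
  \<comment> \<open>With \<open>x = -1\<close> and \<open>y = 1\<close> the weight is the parity
    sign of the ground, written as a difference of indicators so that the sum splits into two
    cardinalities.\<close>
  also have "\<dots> = (\<Sum>c\<in>C. (if even (length (fst c)) then 1 else 0) -
      (if odd (length (fst c)) then 1 else 0))"
    by (auto simp: weight_def intro!: sum.cong)
  also have "\<dots> = of_nat (card {c \<in> C. even (length (fst c))}) -
      of_nat (card {c \<in> C. odd (length (fst c))})"
    using fin by (simp add: sum_subtractf sum.If_cases Int_def)
  finally show ?thesis by (simp add: C_def cp_even_def cp_odd_def conj_ac)
qed

theorem theorem5:
  fixes a m :: nat
  assumes "a \<ge> 1" and "m \<ge> 1"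
  shows "(\<forall>n. cp_odd a a m n \<le> cp_even a a m n) \<and>
    (\<forall>n. 0 \<le> fps_nth
       (qpochhammer_inf (- (fps_X ^ (2 * a))) (fps_X ^ m) /
        (qpochhammer_inf (- (fps_X ^ a)) (fps_X ^ m) * qpochhammer_inf (fps_X ^ a) (fps_X ^ m))
        :: rat fps) n)"
proof (intro conjI allI)
  fix n
  show "cp_odd a a m n \<le> cp_even a a m n"
    using pair_series_signed_nonneg[of a m n] fps_nth_pair_series_signed[of a a m n, where 'a = rat]
      assms by simp
next
  fix n
  define A B where "A = qpochhammer_inf (- (fps_X ^ a)) (fps_X ^ m :: rat fps)"
    and "B = qpochhammer_inf (fps_X ^ a) (fps_X ^ m :: rat fps)"
  have "fps_nth A 0 = 1" "fps_nth B 0 = 1"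
    unfolding A_def B_def using assms by (auto intro!: fps_nth_0_qpochhammer_inf)
  \<comment> \<open>A nonzero denominator lets the product formula be divided by
    \<open>A * B\<close>, so the quotient is exactly the signed series.\<close>
  hence nz: "A * B \<noteq> 0" by auto
  have "qpochhammer_inf (- (fps_X ^ (2 * a))) (fps_X ^ m) =
      A * B * pair_series (- 1 :: rat) 1 a a m 0 0"
    using pair_series_product[of a a m "- 1 :: rat" 1] assms
    by (simp add: A_def B_def mult_2 flip: fps_const_neg)
  hence "qpochhammer_inf (- (fps_X ^ (2 * a))) (fps_X ^ m) / (A * B) =
      pair_series (- 1 :: rat) 1 a a m 0 0"
    using nz by simp
  thus "0 \<le> fps_nth (qpochhammer_inf (- (fps_X ^ (2 * a))) (fps_X ^ m) /
      (qpochhammer_inf (- (fps_X ^ a)) (fps_X ^ m) * qpochhammer_inf (fps_X ^ a) (fps_X ^ m))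
        :: rat fps) n"
    using pair_series_signed_nonneg[OF assms] by (simp only: A_def B_def)
qed

end
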